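(* For every Clobber configuration $C$ and every configuration $C'$ obtained from $C$ by an arbitrary finite sequence of legal moves (not necessarily alternating in color), $\delta(C')\equiv \delta(C) \pmod 3$.
   Context: Clobber is played with black and white stones occupying some squares of a grid board whose squares are colored black and white in a checkerboard pattern. A move consists of picking up a stone and moving it onto a horizontally or vertically adjacent square occupied by a stone of the opposite color; that stone is removed and replaced by the moved stone. A stone is matching if its color equals the color of the square it occupies, and clashing otherwise. For a configuration $C$, $\delta(C)$ denotes the number of stones of $C$ plus the number of clashing stones of $C$. *)

theory Defs
  imports "HOL-Number_Theory.Cong"
begin

datatype colour = Black | White

type_synonym square = "nat \<times> nat"

definition board :: "nat \<Rightarrow> nat \<Rightarrow> square set" where
  "board m n = {..<m} \<times> {..<n}"

fun adjacent :: "square \<Rightarrow> square \<Rightarrow> bool" where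
  "adjacent (i, j) (k, l) \<longleftrightarrow>
     (i = k \<and> (j = Suc l \<or> l = Suc j)) \<or> (j = l \<and> (i = Suc k \<or> k = Suc i))"

(* On a nonempty board this leaves exactly the two checkerboard patterns, given by the colour of
   the corner (0,0); both are admitted. Values of col outside the board are irrelevant. *)
definition checkerboard :: "nat \<Rightarrow> nat \<Rightarrow> (square \<Rightarrow> colour) \<Rightarrow> bool" where
  "checkerboard m n col \<longleftrightarrow>
     (\<forall>p \<in> board m n. \<forall>q \<in> board m n. adjacent p q \<longrightarrow> col p \<noteq> col q)"

(* None: empty square; Some c: square occupied by a stone of colour c. *)
type_synonym config = "square \<Rightarrow> colour option"

definition configuration :: "nat \<Rightarrow> nat \<Rightarrow> config \<Rightarrow> bool" where
  "configuration m n C \<longleftrightarrow> dom C \<subseteq> board m n"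

(* There is no restriction on the colour of the moving stone, so iterating this relation
   gives sequences of moves that need not alternate between the two colours. *)
definition move :: "nat \<Rightarrow> nat \<Rightarrow> config \<Rightarrow> config \<Rightarrow> bool" where
  "move m n C C' \<longleftrightarrow>
     (\<exists>p \<in> board m n. \<exists>q \<in> board m n. \<exists>c d.
        adjacent p q \<and> C p = Some c \<and> C q = Some d \<and> c \<noteq> d \<and>
        C' = C(p := None, q := Some c))"

definition matching :: "(square \<Rightarrow> colour) \<Rightarrow> config \<Rightarrow> square \<Rightarrow> bool" where
  "matching col C p \<longleftrightarrow> C p = Some (col p)"

definition clashing :: "(square \<Rightarrow> colour) \<Rightarrow> config \<Rightarrow> square \<Rightarrow> bool" where
  "clashing col C p \<longleftrightarrow> p \<in> dom C \<and> \<not> matching col C p"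

definition delta :: "(square \<Rightarrow> colour) \<Rightarrow> config \<Rightarrow> nat" where
  "delta col C = card (dom C) + card {p. clashing col C p}"

end

theory Submission
  imports Defs
begin

text \<open>A stone weighs 1 if it matches and 2 if it clashes, and delta is the total weight. The two
  stones involved in a move have different colours and stand on squares of different colours, so
  both match or both clash. In the first case the surviving stone clashes, and the weight of the
  pair stays 2; in the second it matches, and the weight drops from 4 to 1.\<close>

definition weight :: "(square \<Rightarrow> colour) \<Rightarrow> config \<Rightarrow> square \<Rightarrow> nat" where
  "weight col C p = (case C p of None \<Rightarrow> 0 | Some c \<Rightarrow> if c = col p then 1 else 2)"

text \<open>Empty squares weigh 0, so the index set may exceed the set of occupied squares. The
  configurations before and after a move can then be compared over one common set, the whole
  board.\<close>

lemma delta_eq_sum_weight: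
  assumes "finite A" and "dom C \<subseteq> A"
  shows "delta col C = (\<Sum>p\<in>A. weight col C p)"
proof -
  have "dom C = {p \<in> A. p \<in> dom C}"
    using assms(2) by blast
  then have stones: "card (dom C) = (\<Sum>p\<in>A. if p \<in> dom C then 1 else 0)"
    using assms(1) by (simp add: sum.If_cases Int_def)
  have "{p. clashing col C p} = {p \<in> A. clashing col C p}"
    using assms(2) by (auto simp: clashing_def)
  then have clashes: "card {p. clashing col C p} = (\<Sum>p\<in>A. if clashing col C p then 1 else 0)"
    using assms(1) by (simp add: sum.If_cases Int_def)
  show ?thesis
    \<comment> \<open>Square by square, the indicators of being occupied and of clashing add up to
      the weight.\<close>
    unfolding delta_def stones clashes sum.distrib[symmetric]
    by (rule sum.cong)
      (auto simp: weight_def clashing_def matching_def dom_def split: option.split)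
qed

lemma configuration_move:
  assumes "configuration m n C" and "move m n C C'"
  shows "configuration m n C'"
  using assms unfolding configuration_def move_def by (auto split: if_splits)

lemma delta_move_cong:
  assumes "checkerboard m n col" and "configuration m n C" and "move m n C C'"
  shows "[delta col C' = delta col C] (mod 3)"
proof -
  obtain p q c d where pq: "p \<in> board m n" "q \<in> board m n" "adjacent p q"
    and C: "C p = Some c" "C q = Some d" "c \<noteq> d"
    and C': "C' = C(p := None, q := Some c)"
    using assms(3) unfolding move_def by blast
  have col: "col p \<noteq> col q"
    using assms(1) pq unfolding checkerboard_def by blast
  then have "p \<noteq> q"
    by auto
  have fin: "finite (board m n)"
    by (simp add: board_def)
  \<comment> \<open>\<open>f\<close> is arbitrary so that the same splitting serves the weights of
    \<open>C\<close> and of \<open>C'\<close>.\<close>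
  have split: "(\<Sum>x\<in>board m n. f x) = f p + f q + (\<Sum>x\<in>board m n - {p, q}. f x)"
    for f :: "square \<Rightarrow> nat"
    using fin pq(1,2) \<open>p \<noteq> q\<close> sum.subset_diff[of "{p, q}" "board m n" f] by simp
  have rest: "(\<Sum>x\<in>board m n - {p, q}. weight col C' x)
      = (\<Sum>x\<in>board m n - {p, q}. weight col C x)"
    by (rule sum.cong) (auto simp: weight_def C')
  \<comment> \<open>Four colourings survive \<open>c \<noteq> d\<close> and
    \<open>col p \<noteq> col q\<close>: two go from 1 + 1 to 0 + 2, two from 2 + 2 to 0 +
    1.\<close>
  have "[weight col C' p + weight col C' q = weight col C p + weight col C q] (mod 3)"
    using C col \<open>p \<noteq> q\<close>
    by (cases c; cases d; cases "col p"; cases "col q") (auto simp: weight_def C' cong_def)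
  moreover have "delta col C = (\<Sum>x\<in>board m n. weight col C x)"
    using assms(2) fin by (simp add: configuration_def delta_eq_sum_weight)
  moreover have "delta col C' = (\<Sum>x\<in>board m n. weight col C' x)"
    using configuration_move[OF assms(2,3)] fin
    by (simp add: configuration_def delta_eq_sum_weight)
  ultimately show ?thesis
    by (simp only: split rest cong_add_rcancel_nat)
qed

theorem theorem3:
  fixes m n :: nat and col :: "square \<Rightarrow> colour" and C C' :: config
  assumes "checkerboard m n col"
    and "configuration m n C"
    and "(move m n)\<^sup>*\<^sup>* C C'"
  shows "[delta col C' = delta col C] (mod 3)"
proof -
  \<comment> \<open>The first conjunct strengthens the induction: \<open>delta_move_cong\<close>
    needs the stones before each move to lie on the board.\<close>
  have "configuration m n C' \<and> [delta col C' = delta col C] (mod 3)"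
    using assms(3)
  proof induction
    case base
    show ?case
      using assms(2) by simp
  next
    case (step D D')
    then show ?case
      using configuration_move delta_move_cong[OF assms(1)] cong_trans by blast
  qed
  then show ?thesis ..
qed

end
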